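(* For every lattice $\Lambda \subseteq \mathbb{R}^2$ and every strictly convex norm $\Vert \cdot \Vert$ on $\mathbb{R}^2$, the lattice $\Lambda$ has either exactly $4$ or exactly $6$ Voronoi-relevant vectors with respect to $\Vert \cdot \Vert$.
   Context: A lattice $\Lambda \subseteq \mathbb{R}^n$ is a discrete additive subgroup of $\mathbb{R}^n$; all lattices are assumed to have full rank $n$, i.e. $\Lambda$ spans $\mathbb{R}^n$ over $\mathbb{R}$. A vector $v \in \Lambda \setminus \{0\}$ is Voronoi-relevant with respect to $\Vert\cdot\Vert$ if there is some $x \in \mathbb{R}^n$ such that $\Vert x \Vert = \Vert x-v \Vert < \Vert x-w \Vert$ for all $w \in \Lambda \setminus \{0,v\}$. A norm is strictly convex if for all distinct $x,y$ with $\Vert x \Vert = \Vert y \Vert$ and all $\tau \in (0,1)$ we have $\Vert \tau x + (1-\tau) y \Vert < \Vert x \Vert$. *)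

theory Defs
  imports "HOL-Analysis.Analysis"
begin

text \<open>Discreteness refers to the Euclidean topology. A norm is an arbitrary function
  subject to the laws of class \<^class>\<open>real_normed_vector\<close>, because the overloaded constant
  \<^const>\<open>norm\<close> on \<open>real ^ 'n\<close> is the fixed Euclidean norm.\<close>

definition full_rank_lattice :: "'a::euclidean_space set \<Rightarrow> bool" where
  "full_rank_lattice L \<longleftrightarrow>
     0 \<in> L \<and> (\<forall>x\<in>L. \<forall>y\<in>L. x + y \<in> L) \<and> (\<forall>x\<in>L. - x \<in> L) \<and>
     discrete L \<and> span L = UNIV"

definition is_norm :: "('a::real_vector \<Rightarrow> real) \<Rightarrow> bool" where
  "is_norm N \<longleftrightarrow>
     (\<forall>x. N x = 0 \<longleftrightarrow> x = 0) \<and>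
     (\<forall>x y. N (x + y) \<le> N x + N y) \<and>
     (\<forall>a x. N (a *\<^sub>R x) = \<bar>a\<bar> * N x)"

definition strictly_convex_norm :: "('a::real_vector \<Rightarrow> real) \<Rightarrow> bool" where
  "strictly_convex_norm N \<longleftrightarrow> is_norm N \<and>
     (\<forall>x y t. x \<noteq> y \<longrightarrow> N x = N y \<longrightarrow> 0 < t \<longrightarrow> t < 1 \<longrightarrow>
        N (t *\<^sub>R x + (1 - t) *\<^sub>R y) < N x)"

definition voronoi_relevant :: "('a::real_vector \<Rightarrow> real) \<Rightarrow> 'a set \<Rightarrow> 'a \<Rightarrow> bool" where
  "voronoi_relevant N L v \<longleftrightarrow> v \<in> L - {0} \<and>
     (\<exists>x. N x = N (x - v) \<and> (\<forall>w \<in> L - {0, v}. N (x - v) < N (x - w)))"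

end

theory Submission
  imports Defs
begin

text \<open>A vector \<open>v\<close> is Voronoi-relevant iff some ball has \<open>0\<close> and \<open>v\<close> on its boundary and no other
  lattice point inside or on it, so the lattice translates of the segment from \<open>0\<close> to \<open>v\<close> are edges
  of the Delaunay graph for the given norm. In the plane such edges do not cross: if chords of two
  balls crossed, with the ends of each outside the other ball, then seen from the centre of the
  homothety relating the balls the chord of one ball would be nearer on both sides of the crossing
  point, which is impossible for two lines.

  A shortest nonzero vector \<open>e\<close> and a shortest lattice vector \<open>f\<close> outside its span form a basis of
  the lattice, and both are relevant, witnessed by the balls around \<open>e/2\<close> and \<open>f/2\<close>. Noncrossing
  with the translates of \<open>e\<close> and \<open>f\<close> forces every relevant vector to have coefficients in
  \<open>{-1, 0, 1}\<close>, and \<open>e + f\<close> and \<open>e - f\<close> are not both relevant because the diagonals of a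
  fundamental parallelogram cross.\<close>

section \<open>Planar determinants\<close>

definition cross2 :: "real ^ 2 \<Rightarrow> real ^ 2 \<Rightarrow> real" where
  "cross2 a b = a $ 1 * b $ 2 - a $ 2 * b $ 1"

lemma cross2_swap: "cross2 a b = - cross2 b a"
  by (simp add: cross2_def)

lemma cross2_diff_left: "cross2 (a - b) c = cross2 a c - cross2 b c"
  and cross2_diff_right: "cross2 a (b - c) = cross2 a b - cross2 a c"
  and cross2_add_left: "cross2 (a + b) c = cross2 a c + cross2 b c"
  and cross2_add_right: "cross2 a (b + c) = cross2 a b + cross2 a c"
  and cross2_scale_left: "cross2 (s *\<^sub>R a) b = s * cross2 a b"
  and cross2_scale_right: "cross2 a (s *\<^sub>R b) = s * cross2 a b"
  and cross2_self [simp]: "cross2 a a = 0"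
  by (simp_all add: cross2_def algebra_simps)

lemmas cross2_linear = cross2_diff_left cross2_diff_right cross2_add_left cross2_add_right
  cross2_scale_left cross2_scale_right

text \<open>Three vectors in the plane are linearly dependent, with their pairwise determinants as
  coefficients (Cramer's rule).\<close>

lemma cross2_cyclic: "cross2 a b *\<^sub>R c + cross2 c a *\<^sub>R b = cross2 c b *\<^sub>R a"
  by (simp add: cross2_def vec_eq_iff forall_2 algebra_simps)

section \<open>Crossing chords of homothetic convex sets\<close>

lemma scaleR_image_mem_iff:
  fixes y :: "'a::real_vector"
  assumes "k \<noteq> 0"
  shows "y \<in> (*\<^sub>R) k ` B \<longleftrightarrow> inverse k *\<^sub>R y \<in> B"
proof
  assume "inverse k *\<^sub>R y \<in> B"
  then have "k *\<^sub>R (inverse k *\<^sub>R y) \<in> (*\<^sub>R) k ` B" by (rule imageI)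
  then show "y \<in> (*\<^sub>R) k ` B" using assms by simp
qed (use assms in auto)

lemma mem_convex_ray:
  fixes s :: "'a::real_vector"
  assumes "convex B" "a *\<^sub>R s \<in> B" "b *\<^sub>R s \<in> B" "a \<le> c" "c \<le> b"
  shows "c *\<^sub>R s \<in> B"
proof (cases "a = b")
  case False
  then have ab: "a < b" using assms by simp
  have "((b - c) / (b - a)) *\<^sub>R (a *\<^sub>R s) + ((c - a) / (b - a)) *\<^sub>R (b *\<^sub>R s) \<in> B"
    using assms ab by (intro convexD) (auto simp: divide_simps)
  moreover have "((b - c) / (b - a)) * a + ((c - a) / (b - a)) * b = c"
    using ab by (simp add: divide_simps) (simp add: algebra_simps)
  ultimately show ?thesis
    by (simp flip: scaleR_add_left)
qed (use assms in auto)

text \<open>On the ray from the homothety centre \<open>0\<close> through \<open>p'\<close> (or through \<open>p\<close>), the segment from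
  \<open>z\<close> to \<open>p'\<close> passes nearer to \<open>0\<close> than the segment from \<open>z\<close> to \<open>p\<close>. In the plane
  \<open>A = z \<times> p\<close>, \<open>A' = z \<times> p'\<close> and \<open>E = p \<times> p'\<close>, up to a common sign, and the
  conclusion says that \<open>(p - z) \<times> (p' - z)\<close> has that sign.\<close>

lemma shadow_order:
  fixes z p p' :: "'a::real_vector"
  assumes B: "convex B" "0 \<notin> B" and k: "0 < k" "k < 1"
    and z: "z \<in> B" "z \<in> (*\<^sub>R) k ` B"
    and p: "p \<in> B" "p \<notin> (*\<^sub>R) k ` B"
    and p': "p' \<notin> B" "p' \<in> (*\<^sub>R) k ` B"
    and A: "0 \<le> A" "0 \<le> A'" "0 < A + A'"
    and rel: "E *\<^sub>R z + A *\<^sub>R p' = A' *\<^sub>R p"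
  shows "A' < E + A"
proof (rule ccontr)
  assume "\<not> A' < E + A"
  then have le: "E + A \<le> A'" by simp
  have C: "convex ((*\<^sub>R) k ` B)" "0 \<notin> (*\<^sub>R) k ` B"
    using B k by (auto simp: convex_scaling)
  show False
  proof (cases "E \<le> 0")
    case True
    have S: "0 < A' - E"
      using True A le by linarith
    \<comment> \<open>The ray through \<open>p'\<close> meets the segment from \<open>z\<close> to
      \<open>p\<close> in \<open>s\<close>, and \<open>p'\<close> is \<open>s\<close> times a factor
      at least 1. As \<open>inverse k *\<^sub>R p'\<close> lies in \<open>B\<close> still further
      out, convexity would put \<open>p'\<close> into \<open>B\<close>.\<close>
    define s where "s = (A' / (A' - E)) *\<^sub>R p + (- E / (A' - E)) *\<^sub>R z"
    have s: "s \<in> B"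
      unfolding s_def using B z p A True S
      by (intro convexD) (auto simp: divide_simps)
    have "(A' - E) *\<^sub>R s = A' *\<^sub>R p - E *\<^sub>R z"
      using S by (simp add: s_def scaleR_diff_right)
    also have "\<dots> = A *\<^sub>R p'"
      using rel by (simp add: algebra_simps)
    finally have eq: "(A' - E) *\<^sub>R s = A *\<^sub>R p'" .
    have "A \<noteq> 0"
    proof
      assume "A = 0"
      then have "s = 0" using eq S by simp
      then show False using s B by simp
    qed
    then have Apos: "0 < A" using A by simp
    have "inverse A *\<^sub>R (A *\<^sub>R p') = inverse A *\<^sub>R ((A' - E) *\<^sub>R s)"
      by (simp only: eq)
    then have p's: "p' = ((A' - E) / A) *\<^sub>R s"
      using Apos by (simp add: divide_inverse mult.commute)
    have "inverse k *\<^sub>R p' \<in> B"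
      using p' k scaleR_image_mem_iff[of k p' B] by simp
    then have "(inverse k * ((A' - E) / A)) *\<^sub>R s \<in> B"
      by (simp add: p's)
    moreover have "1 \<le> (A' - E) / A"
      using le Apos by simp
    moreover have "(A' - E) / A \<le> inverse k * ((A' - E) / A)"
      using mult_right_mono[of 1 "inverse k" "(A' - E) / A"] k S Apos one_le_inverse[of k] by simp
    ultimately have "p' \<in> B"
      unfolding p's using mem_convex_ray[OF B(1), of 1 s] s by simp
    then show False using p' by simp
  next
    case False
    then have E: "0 < E" by simp
    then have A': "0 < A'" using le A by linarith
    have S: "0 < E + A" using E A by linarith
    \<comment> \<open>Now the ray through \<open>p\<close> meets the segment from \<open>z\<close>
      to \<open>p'\<close> in \<open>s\<close>. Both \<open>s\<close> and
      \<open>k *\<^sub>R p\<close> lie in the scaled set, with \<open>p\<close> between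
      them.\<close>
    define s where "s = (E / (E + A)) *\<^sub>R z + (A / (E + A)) *\<^sub>R p'"
    have s: "s \<in> (*\<^sub>R) k ` B"
      unfolding s_def using C z p' A E S
      by (intro convexD) (auto simp: divide_simps)
    have "(E + A) *\<^sub>R s = E *\<^sub>R z + A *\<^sub>R p'"
      using S by (simp add: s_def scaleR_add_right)
    then have eq: "(E + A) *\<^sub>R s = A' *\<^sub>R p"
      using rel by simp
    have "inverse A' *\<^sub>R (A' *\<^sub>R p) = inverse A' *\<^sub>R ((E + A) *\<^sub>R s)"
      by (simp only: eq)
    then have ps: "p = ((E + A) / A') *\<^sub>R s"
      using A' by (simp add: divide_inverse mult.commute)
    have "k *\<^sub>R p \<in> (*\<^sub>R) k ` B"
      using p(1) by (rule imageI)
    then have "(k * ((E + A) / A')) *\<^sub>R s \<in> (*\<^sub>R) k ` B"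
      by (simp add: ps)
    moreover have "k * ((E + A) / A') \<le> (E + A) / A'"
      using k S A' by (intro mult_left_le_one_le) auto
    moreover have "(E + A) / A' \<le> 1"
      using le A' by simp
    ultimately have "p \<in> (*\<^sub>R) k ` B"
      unfolding ps using mem_convex_ray[OF C(1), of "k * ((E + A) / A')" s 1 "(E + A) / A'"] s
      by simp
    then show False using p by simp
  qed
qed

text \<open>The orientation puts \<open>p\<close>, \<open>p'\<close> weakly on one side of the line
  through 0 and \<open>z\<close>, and \<open>q\<close>, \<open>q'\<close> on the other. Applying
  \<open>shadow_order\<close> on each side gives the determinant of the two chord directions
  opposite signs.\<close>

lemma homothetic_chords_oriented:
  fixes p q p' q' z :: "real ^ 2"
  assumes B: "convex B" and k: "0 < k" "k < 1"
    and p: "p \<in> B" "p \<notin> (*\<^sub>R) k ` B" and q: "q \<in> B" "q \<notin> (*\<^sub>R) k ` B"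
    and p': "p' \<notin> B" "p' \<in> (*\<^sub>R) k ` B" and q': "q' \<notin> B" "q' \<in> (*\<^sub>R) k ` B"
    and z: "z \<in> closed_segment p q" "z \<in> closed_segment p' q'"
    and indep: "cross2 (p - q) (p' - q') \<noteq> 0"
    and orient: "0 \<le> cross2 z (p - q)" "0 \<le> cross2 z (p' - q')"
  shows False
proof -
  \<comment> \<open>If 0 were in \<open>B\<close>, scaling by \<open>k < 1\<close> would map
    \<open>B\<close> into itself, against the position of \<open>p'\<close>.\<close>
  have B0: "0 \<notin> B"
  proof
    assume "0 \<in> B"
    obtain y where y: "y \<in> B" "p' = k *\<^sub>R y" using p' by auto
    have "k *\<^sub>R y \<in> B"
      using mem_convex_ray[OF B, of 0 y 1 k] \<open>0 \<in> B\<close> y k by simp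
    then show False using y p' by simp
  qed
  have zB: "z \<in> B" "z \<in> (*\<^sub>R) k ` B"
    using z closed_segment_subset[of p B q] closed_segment_subset[of p' "(*\<^sub>R) k ` B" q']
      B convex_scaling[OF B, of k] p(1) q(1) p'(2) q'(2) by (meson subsetD)+
  obtain l where l: "0 \<le> l" "l \<le> 1" "z = (1 - l) *\<^sub>R p + l *\<^sub>R q"
    using z(1) by (auto simp: in_segment)
  obtain m where m: "0 \<le> m" "m \<le> 1" "z = (1 - m) *\<^sub>R p' + m *\<^sub>R q'"
    using z(2) by (auto simp: in_segment)
  \<comment> \<open>The crossing point lies in both sets and each endpoint in only one, so
    \<open>z\<close> is interior to both chords.\<close>
  have l01: "l \<noteq> 0" "l \<noteq> 1" using l(3) zB p q by auto
  have m01: "m \<noteq> 0" "m \<noteq> 1" using m(3) zB p' q' by auto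
  have d: "p - z = l *\<^sub>R (p - q)" "q - z = - ((1 - l) *\<^sub>R (p - q))"
    unfolding l(3) by (simp_all add: algebra_simps)
  have d': "p' - z = m *\<^sub>R (p' - q')" "q' - z = - ((1 - m) *\<^sub>R (p' - q'))"
    unfolding m(3) by (simp_all add: algebra_simps)
  define \<alpha> \<beta> where "\<alpha> = cross2 z (p - q)" and "\<beta> = cross2 z (p' - q')"
  have "z \<noteq> 0" using zB B0 by auto
  \<comment> \<open>If both determinants vanished, both chords would be parallel to
    \<open>z\<close>.\<close>
  have pos: "0 < \<alpha> + \<beta>"
  proof (rule ccontr)
    assume "\<not> 0 < \<alpha> + \<beta>"
    then have "\<alpha> = 0" "\<beta> = 0" using orient by (auto simp: \<alpha>_def \<beta>_def)
    then have "cross2 (p - q) (p' - q') *\<^sub>R z = 0"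
      using cross2_cyclic[of "p' - q'" z "p - q"] cross2_cyclic[of z "p' - q'" "p - q"]
      by (simp add: \<alpha>_def \<beta>_def cross2_swap[of _ z])
    then show False using \<open>z \<noteq> 0\<close> indep by simp
  qed
  have c: "cross2 z p = l * \<alpha>" "cross2 z p' = m * \<beta>"
      "cross2 z q = - (1 - l) * \<alpha>" "cross2 z q' = - (1 - m) * \<beta>"
    using arg_cong[OF d(1), of "cross2 z"] arg_cong[OF d(2), of "cross2 z"]
      arg_cong[OF d'(1), of "cross2 z"] arg_cong[OF d'(2), of "cross2 z"]
    by (simp_all add: \<alpha>_def \<beta>_def cross2_linear cross2_def algebra_simps)
  have sum_pos: "0 < a * \<alpha> + b * \<beta>" if "0 < a" "0 < b" for a b
  proof (cases "\<alpha> = 0")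
    case True
    then show ?thesis using that pos by simp
  next
    case False
    then have "0 < a * \<alpha>" using that orient by (simp add: \<alpha>_def)
    moreover have "0 \<le> b * \<beta>" using that orient by (simp add: \<beta>_def)
    ultimately show ?thesis by linarith
  qed
  have "m * \<beta> < cross2 p p' + l * \<alpha>"
  proof (rule shadow_order[OF B B0 k zB p p'])
    show "cross2 p p' *\<^sub>R z + (l * \<alpha>) *\<^sub>R p' = (m * \<beta>) *\<^sub>R p"
      using cross2_cyclic[of p p' z] unfolding c by simp
  qed (use l m l01 m01 orient sum_pos in \<open>auto simp: \<alpha>_def \<beta>_def\<close>)
  moreover have "cross2 p p' + l * \<alpha> - m * \<beta> = l * m * cross2 (p - q) (p' - q')"
  proof -
    have "cross2 p p' + l * \<alpha> - m * \<beta> = cross2 (p - z) (p' - z)"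
      unfolding c[symmetric] by (simp add: cross2_def algebra_simps)
    then show ?thesis by (simp add: d d' cross2_scale_left cross2_scale_right)
  qed
  ultimately have 1: "0 < l * m * cross2 (p - q) (p' - q')" by linarith
  have "(1 - m) * \<beta> < - cross2 q q' + (1 - l) * \<alpha>"
  proof (rule shadow_order[OF B B0 k zB q q'])
    show "- cross2 q q' *\<^sub>R z + ((1 - l) * \<alpha>) *\<^sub>R q' = ((1 - m) * \<beta>) *\<^sub>R q"
      using cross2_cyclic[of q q' z] unfolding c by (simp add: algebra_simps)
  qed (use l m l01 m01 orient sum_pos in \<open>auto simp: \<alpha>_def \<beta>_def\<close>)
  moreover have "- cross2 q q' + (1 - l) * \<alpha> - (1 - m) * \<beta>
      = - ((1 - l) * (1 - m) * cross2 (p - q) (p' - q'))"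
  proof -
    have "- cross2 q q' + (1 - l) * \<alpha> - (1 - m) * \<beta> = - cross2 (q - z) (q' - z)"
      using c by (simp add: cross2_def algebra_simps)
    also have "cross2 (q - z) (q' - z) = (1 - l) * (1 - m) * cross2 (p - q) (p' - q')"
      unfolding d d' by (simp add: cross2_def algebra_simps)
    finally show ?thesis .
  qed
  ultimately have 2: "(1 - l) * (1 - m) * cross2 (p - q) (p' - q') < 0" by linarith
  have "0 < l * m" "0 < (1 - l) * (1 - m)"
    using l m l01 m01 by (auto intro!: mult_pos_pos)
  with 1 2 have "0 < cross2 (p - q) (p' - q')" "cross2 (p - q) (p' - q') < 0"
    using zero_less_mult_pos[of "l * m"] mult_nonneg_nonneg[of "(1 - l) * (1 - m)"]
    by (blast, meson less_imp_le not_less)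
  then show False by simp
qed

text \<open>Exchanging the endpoints of a chord flips the sign of its determinant with
  \<open>z\<close>, so the orientation can always be arranged.\<close>

lemma homothetic_chords_disjoint:
  fixes p q p' q' z :: "real ^ 2"
  assumes B: "convex B" and k: "0 < k" "k < 1"
    and p: "p \<in> B" "p \<notin> (*\<^sub>R) k ` B" and q: "q \<in> B" "q \<notin> (*\<^sub>R) k ` B"
    and p': "p' \<notin> B" "p' \<in> (*\<^sub>R) k ` B" and q': "q' \<notin> B" "q' \<in> (*\<^sub>R) k ` B"
    and z: "z \<in> closed_segment p q" "z \<in> closed_segment p' q'"
    and indep: "cross2 (p - q) (p' - q') \<noteq> 0"
  shows False
proof -
  have flip: "cross2 u (v - w) = - cross2 u (w - v)" for u v w
    by (simp_all add: cross2_linear)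
  have z': "z \<in> closed_segment q p" "z \<in> closed_segment q' p'"
    using z by (simp_all add: closed_segment_commute)
  have i: "cross2 (p - q) (q' - p') \<noteq> 0" "cross2 (q - p) (p' - q') \<noteq> 0"
      "cross2 (q - p) (q' - p') \<noteq> 0"
    using indep by (simp_all add: cross2_linear)
  consider "0 \<le> cross2 z (p - q)" "0 \<le> cross2 z (p' - q')"
    | "0 \<le> cross2 z (p - q)" "0 \<le> cross2 z (q' - p')"
    | "0 \<le> cross2 z (q - p)" "0 \<le> cross2 z (p' - q')"
    | "0 \<le> cross2 z (q - p)" "0 \<le> cross2 z (q' - p')"
    using flip[of z p q] flip[of z p' q'] by linarith
  then show False
    using homothetic_chords_oriented[OF B k p q p' q' z indep]
      homothetic_chords_oriented[OF B k p q q' p' z(1) z'(2) i(1)]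
      homothetic_chords_oriented[OF B k q p p' q' z'(1) z(2) i(2)]
      homothetic_chords_oriented[OF B k q p q' p' z' i(3)]
    by cases
qed

section \<open>Norms and strict convexity\<close>

context
  fixes N :: "'a::real_vector \<Rightarrow> real"
  assumes N: "is_norm N"
begin

lemma is_norm_zero: "N 0 = 0"
  and is_norm_eq_0: "N x = 0 \<longleftrightarrow> x = 0"
  and is_norm_add: "N (x + y) \<le> N x + N y"
  and is_norm_scale: "N (a *\<^sub>R x) = \<bar>a\<bar> * N x"
  using N by (auto simp: is_norm_def)

lemma is_norm_minus: "N (- x) = N x"
  using is_norm_scale[of "-1" x] by simp

lemma is_norm_commute: "N (x - y) = N (y - x)"
  using is_norm_minus[of "x - y"] by simp

lemma is_norm_nonneg: "0 \<le> N x"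
  using is_norm_add[of x "- x"] by (simp add: is_norm_minus is_norm_zero)

lemma convex_is_norm_ball: "convex {y. N (y + a) \<le> r}"
proof (rule convexI)
  fix x y and u v :: real
  assume h: "x \<in> {y. N (y + a) \<le> r}" "y \<in> {y. N (y + a) \<le> r}" "0 \<le> u" "0 \<le> v" "u + v = 1"
  have "a = u *\<^sub>R a + v *\<^sub>R a"
    using h by (simp flip: scaleR_add_left)
  then have "u *\<^sub>R x + v *\<^sub>R y + a = u *\<^sub>R (x + a) + v *\<^sub>R (y + a)"
    by (simp add: algebra_simps)
  then have "N (u *\<^sub>R x + v *\<^sub>R y + a) \<le> u * N (x + a) + v * N (y + a)"
    using is_norm_add[of "u *\<^sub>R (x + a)" "v *\<^sub>R (y + a)"] h by (simp add: is_norm_scale)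
  also have "\<dots> \<le> u * r + v * r"
    using h by (intro add_mono mult_left_mono) auto
  also have "\<dots> = r" using h by (simp flip: distrib_right)
  finally show "u *\<^sub>R x + v *\<^sub>R y \<in> {y. N (y + a) \<le> r}" by simp
qed

end

text \<open>For equal norms this is strict convexity at the midpoint; for different norms one of
  them is already below \<open>r\<close>.\<close>

lemma strictly_convex_norm_add_less:
  assumes N: "strictly_convex_norm N" and "N u \<le> r" "N v \<le> r" "u \<noteq> v"
  shows "N (u + v) < 2 * r"
proof -
  have n: "is_norm N" using N by (simp add: strictly_convex_norm_def)
  show ?thesis
  proof (cases "N u = N v")
    case True
    have "N ((1 / 2) *\<^sub>R u + (1 - 1 / 2) *\<^sub>R v) < N u"
      using N True \<open>u \<noteq> v\<close> unfolding strictly_convex_norm_def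
      by (elim conjE allE[of _ u] allE[of _ v] allE[of _ "1 / 2"]) simp
    moreover have "(1 / 2) *\<^sub>R u + (1 - 1 / 2) *\<^sub>R v = (1 / 2) *\<^sub>R (u + v)"
      by (simp add: algebra_simps)
    ultimately show ?thesis
      using is_norm_scale[OF n, of "1/2" "u + v"] assms by simp
  next
    case False
    then show ?thesis using is_norm_add[OF n, of u v] assms by linarith
  qed
qed

section \<open>Crossing chords of norm balls\<close>

text \<open>Balls of different radii are homothetic with ratio \<open>r' / r\<close>. Moving the
  homothety centre to the origin reduces the claim to
  \<open>homothetic_chords_disjoint\<close>.\<close>

lemma norm_balls_chords_disjoint_aux:
  fixes N :: "real ^ 2 \<Rightarrow> real"
  assumes N: "is_norm N" and r: "0 < r'" "r' < r"
    and p: "N (p - x) \<le> r" "r' < N (p - x')" and q: "N (q - x) \<le> r" "r' < N (q - x')"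
    and p': "N (p' - x') \<le> r'" "r < N (p' - x)" and q': "N (q' - x') \<le> r'" "r < N (q' - x)"
    and z: "z \<in> closed_segment p q" "z \<in> closed_segment p' q'"
    and indep: "cross2 (p - q) (p' - q') \<noteq> 0"
  shows False
proof -
  define k where "k = r' / r"
  have k: "0 < k" "k < 1" and kr: "k * r = r'" using r by (auto simp: k_def)
  \<comment> \<open>the centre of the homothety taking the larger ball to the smaller one\<close>
  define c where "c = inverse (1 - k) *\<^sub>R (x' - k *\<^sub>R x)"
  have "(1 - k) *\<^sub>R c = x' - k *\<^sub>R x"
    using k by (simp add: c_def)
  then have c: "c - x' = k *\<^sub>R (c - x)" by (simp add: algebra_simps)
  define B where "B = {y. N (y + (c - x)) \<le> r}"
  have B: "y - c \<in> B \<longleftrightarrow> N (y - x) \<le> r" for y by (simp add: B_def)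
  have C: "y - c \<in> (*\<^sub>R) k ` B \<longleftrightarrow> N (y - x') \<le> r'" for y
  proof -
    have "y - x' = k *\<^sub>R (inverse k *\<^sub>R (y - c) + (c - x))"
      using k by (simp add: scaleR_add_right flip: c)
    then have "N (y - x') = k * N (inverse k *\<^sub>R (y - c) + (c - x))"
      using k(1) by (simp only: is_norm_scale[OF N] abs_of_pos)
    then show ?thesis
      using k by (simp add: scaleR_image_mem_iff B_def flip: kr)
  qed
  have seg: "z - c \<in> closed_segment (a - c) (b - c)" if "z \<in> closed_segment a b" for a b
    using that closed_segment_translation_eq[of "- c" z a b] by simp
  show False
    by (rule homothetic_chords_disjoint[of B k "p - c" "q - c" "p' - c" "q' - c" "z - c"])
      (use k p q p' q' z seg indep in \<open>auto simp: B C B_def[symmetric] intro: convex_is_norm_ball[OF N, of "c - x" r, folded B_def]\<close>)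
qed

lemma norm_balls_chords_disjoint:
  fixes N :: "real ^ 2 \<Rightarrow> real"
  assumes N: "is_norm N"
    and p: "N (p - x) \<le> r" "r' < N (p - x')" and q: "N (q - x) \<le> r" "r' < N (q - x')"
    and p': "N (p' - x') \<le> r'" "r < N (p' - x)" and q': "N (q' - x') \<le> r'" "r < N (q' - x)"
    and z: "z \<in> closed_segment p q" "z \<in> closed_segment p' q'"
    and indep: "cross2 (p - q) (p' - q') \<noteq> 0"
  shows False
proof -
  \<comment> \<open>Enlarging both radii slightly makes them different, so that a homothety centre exists.\<close>
  define s where "s = min (N (p - x')) (N (q - x'))"
  define t where "t = min (N (p' - x)) (N (q' - x))"
  have nn: "0 \<le> r" "0 \<le> r'"
    using is_norm_nonneg[OF N] p(1) p'(1) order_trans by blast+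
  have "r' < s" "r < t" using p q p' q' by (auto simp: s_def t_def)
  obtain r1 where r1: "r < r1" "r1 < t" using \<open>r < t\<close> dense by blast
  obtain r2 where r2: "r' < r2" "r2 < s" "r2 \<noteq> r1"
  proof -
    \<comment> \<open>Of two distinct candidates at least one differs from
      \<open>r1\<close>.\<close>
    obtain u where u: "r' < u" "u < s" using \<open>r' < s\<close> dense by blast
    obtain v where v: "r' < v" "v < u" using u dense by blast
    show ?thesis
      using that[of u] that[of v] u v by fastforce
  qed
  have indep': "cross2 (p' - q') (p - q) \<noteq> 0"
    using indep cross2_swap[of "p - q" "p' - q'"] by simp
  from \<open>r2 \<noteq> r1\<close> consider "r2 < r1" | "r1 < r2" by linarith
  then show False
  proof cases
    case 1
    show False
      by (rule norm_balls_chords_disjoint_aux[OF N _ 1, of p x x' q p' q' z])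
        (use nn r1 r2 p q p' q' z indep in \<open>auto simp: s_def t_def\<close>)
  next
    case 2
    show False
      by (rule norm_balls_chords_disjoint_aux[OF N _ 2, of p' x' x q' p q z])
        (use nn r1 r2 p q p' q' z indep' in \<open>auto simp: s_def t_def\<close>)
  qed
qed

section \<open>Comparison with the Euclidean norm\<close>

lemma is_norm_continuous_on:
  fixes N :: "'a::euclidean_space \<Rightarrow> real"
  assumes N: "is_norm N"
  shows "continuous_on S N"
proof -
  have "convex_on UNIV N"
  proof (rule convex_onI)
    fix t :: real and x y
    assume "0 < t" "t < 1"
    then show "N ((1 - t) *\<^sub>R x + t *\<^sub>R y) \<le> (1 - t) * N x + t * N y"
      using is_norm_add[OF N, of "(1 - t) *\<^sub>R x" "t *\<^sub>R y"] by (simp add: is_norm_scale[OF N])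
  qed simp
  then have "continuous_on UNIV N"
    by (rule convex_on_continuous[OF open_UNIV])
  then show ?thesis by (rule continuous_on_subset) simp
qed

text \<open>The constant is the minimum of \<open>N\<close> on the compact Euclidean unit sphere.
  The bound makes sets bounded in \<open>N\<close> bounded in the Euclidean sense, where
  discreteness is assumed.\<close>

lemma is_norm_lower_bound:
  fixes N :: "'a::euclidean_space \<Rightarrow> real"
  assumes N: "is_norm N"
  obtains c where "0 < c" "\<And>y. c * norm y \<le> N y"
proof -
  obtain b :: 'a where "b \<in> Basis" using nonempty_Basis by blast
  then have "sphere (0::'a) 1 \<noteq> {}" by (auto intro!: exI[of _ b])
  then obtain x where x: "norm x = 1" "\<And>y. norm y = 1 \<Longrightarrow> N x \<le> N y"
    using continuous_attains_inf[of "sphere (0::'a) 1" N] is_norm_continuous_on[OF N]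
    by auto
  show ?thesis
  proof
    have "N x \<noteq> 0" using x(1) is_norm_eq_0[OF N, of x] by auto
    then show "0 < N x" using is_norm_nonneg[OF N, of x] by simp
    show "N x * norm y \<le> N y" for y
    proof (cases "y = 0")
      case True
      then show ?thesis by (simp add: is_norm_zero[OF N])
    next
      case False
      then have "N x \<le> N (inverse (norm y) *\<^sub>R y)" by (intro x(2)) simp
      then show ?thesis using False by (simp add: is_norm_scale[OF N] field_simps)
    qed
  qed
qed

section \<open>Lattices, minimal vectors and empty balls\<close>

context
  fixes L :: "'a::euclidean_space set"
  assumes L: "full_rank_lattice L"
begin

lemma lattice_zero: "0 \<in> L"
  and lattice_add: "x \<in> L \<Longrightarrow> y \<in> L \<Longrightarrow> x + y \<in> L"
  and lattice_minus: "x \<in> L \<Longrightarrow> - x \<in> L"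
  and lattice_span: "span L = UNIV"
  using L by (auto simp: full_rank_lattice_def)

lemma lattice_diff: "x \<in> L \<Longrightarrow> y \<in> L \<Longrightarrow> x - y \<in> L"
  using lattice_add[of x "- y"] lattice_minus[of y] by simp

lemma lattice_scale_int:
  assumes "x \<in> L"
  shows "of_int a *\<^sub>R x \<in> L"
proof -
  have nat: "of_nat n *\<^sub>R x \<in> L" for n
    by (induction n) (auto simp: lattice_zero scaleR_add_left intro: lattice_add assms)
  show ?thesis
    using nat[of "nat a"] lattice_minus[OF nat[of "nat (- a)"]] by (cases "0 \<le> a") auto
qed

lemma lattice_uniform_discrete: "uniform_discrete L"
proof -
  have "0 isolated_in L"
    using L by (auto simp: full_rank_lattice_def discrete_def)
  then obtain e where e: "0 < e" "\<And>y. y \<in> L \<Longrightarrow> dist 0 y < e \<Longrightarrow> y = 0"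
    unfolding isolated_in_dist_Ex_iff by blast
  then have "x = y" if "x \<in> L" "y \<in> L" "dist x y < e" for x y
    using e(2)[of "x - y"] lattice_diff[of x y] that by (simp add: dist_norm norm_minus_commute)
  then show ?thesis unfolding uniform_discrete_def using e(1) by blast
qed

lemma lattice_finite_ball:
  assumes N: "is_norm N"
  shows "finite {w \<in> L. N w \<le> R}"
proof -
  obtain c where c: "0 < c" "\<And>y. c * norm y \<le> N y" using is_norm_lower_bound[OF N] by blast
  have "norm w \<le> R / c" if "N w \<le> R" for w
    using c(1) order_trans[OF c(2) that] by (simp add: field_simps)
  then have "bounded {w \<in> L. N w \<le> R}" by (auto simp: bounded_iff)
  moreover have "uniform_discrete {w \<in> L. N w \<le> R}"
    using lattice_uniform_discrete by (rule uniform_discrete_subset) auto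
  ultimately show ?thesis using uniform_discrete_finite_iff by blast
qed

text \<open>Only finitely many lattice vectors are no longer than a given one. The choices
  \<open>{0}\<close> and \<open>span {e}\<close> for \<open>S\<close> yield the two successive
  minima.\<close>

lemma lattice_minimal_outside:
  assumes N: "is_norm N" and "\<not> L \<subseteq> S"
  shows "\<exists>v\<in>L. v \<notin> S \<and> (\<forall>w\<in>L. w \<notin> S \<longrightarrow> N v \<le> N w)"
proof -
  obtain u where u: "u \<in> L" "u \<notin> S" using assms by blast
  define F where "F = {w \<in> L. N w \<le> N u} - S"
  have F: "finite F" "F \<noteq> {}"
    using lattice_finite_ball[OF N] u by (auto simp: F_def)
  define v where "v = arg_min_on N F"
  have v: "v \<in> F" "\<And>w. w \<in> F \<Longrightarrow> N v \<le> N w"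
    using arg_min_if_finite[OF F, of N] by (auto simp: v_def not_less)
  show ?thesis
  proof (intro bexI[of _ v] conjI ballI impI)
    fix w assume "w \<in> L" "w \<notin> S"
    then show "N v \<le> N w"
      using v(2)[of w] v(1) by (cases "w \<in> F") (auto simp: F_def)
  qed (use v in \<open>auto simp: F_def\<close>)
qed

text \<open>The witness is half of \<open>v\<close>. Another lattice point \<open>w\<close> in the
  closed ball around it through 0 would make both \<open>w\<close> and \<open>v - w\<close> shorter
  than \<open>v\<close>, hence elements of \<open>S\<close>, and so would be their sum
  \<open>v\<close>.\<close>

lemma voronoi_relevant_minimal:
  assumes N: "strictly_convex_norm N" and S: "subspace S"
    and v: "v \<in> L" "v \<notin> S" "\<And>w. w \<in> L \<Longrightarrow> w \<notin> S \<Longrightarrow> N v \<le> N w"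
  shows "voronoi_relevant N L v"
proof -
  have n: "is_norm N" using N by (simp add: strictly_convex_norm_def)
  define x where "x = (1 / 2) *\<^sub>R v"
  have vx: "v = x + x" by (simp add: x_def flip: scaleR_add_left)
  then have xv: "x - v = - x" by simp
  have Nx: "N x = N v / 2" by (simp add: x_def is_norm_scale[OF n])
  have "N (x - v) < N (x - w)" if w: "w \<in> L - {0, v}" for w
  proof (rule ccontr)
    assume "\<not> ?thesis"
    then have le: "N (x - w) \<le> N x" by (simp add: xv is_norm_minus[OF n])
    \<comment> \<open>The two sums are \<open>w\<close> and \<open>v - w\<close>. The summands
      differ because \<open>w\<close> is neither \<open>v\<close> nor 0.\<close>
    have "N (x + (w - x)) < 2 * N x"
      using le w vx by (intro strictly_convex_norm_add_less[OF N]) (auto simp: is_norm_commute[OF n, of w] algebra_simps)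
    moreover have "N (x + (x - w)) < 2 * N x"
      using le w by (intro strictly_convex_norm_add_less[OF N]) auto
    ultimately have "N w < N v" "N (v - w) < N v"
      using Nx vx by (auto simp: algebra_simps)
    then have "w \<in> S" "v - w \<in> S"
      using v(3)[of w] v(3)[of "v - w"] w v(1) lattice_diff by fastforce+
    then have "w + (v - w) \<in> S" by (intro subspace_add[OF S])
    then show False using v by simp
  qed
  moreover have "v \<noteq> 0" using v(2) subspace_0[OF S] by auto
  ultimately show ?thesis
    unfolding voronoi_relevant_def
    by (intro conjI exI[of _ x]) (auto simp: v xv is_norm_minus[OF n])
qed

text \<open>Translation by \<open>- v\<close> takes the pair 0, \<open>v\<close> to
  \<open>- v\<close>, 0 and the witness \<open>x\<close> to \<open>x - v\<close>.\<close>

lemma voronoi_relevant_minus: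
  assumes N: "is_norm N" and v: "voronoi_relevant N L v"
  shows "voronoi_relevant N L (- v)"
proof -
  obtain x where x: "N x = N (x - v)" "\<And>w. w \<in> L - {0, v} \<Longrightarrow> N (x - v) < N (x - w)"
    and vL: "v \<in> L" "v \<noteq> 0"
    using v by (auto simp: voronoi_relevant_def)
  have "N x < N (x - v - w)" if "w \<in> L - {0, - v}" for w
  proof -
    have "v + w \<in> L - {0, v}"
      using that lattice_add vL by (auto simp: add_eq_0_iff2 add_eq_0_iff)
    then show ?thesis using x(1) x(2)[of "v + w"] by (simp add: algebra_simps)
  qed
  then show ?thesis
    unfolding voronoi_relevant_def
    by (intro conjI exI[of _ "x - v"]) (use vL x lattice_minus in auto)
qed

lemma voronoi_relevant_empty_ball:
  assumes N: "is_norm N" and v: "voronoi_relevant N L v" and u: "u \<in> L"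
  obtains c r where "N (u - c) = r" "N (u + v - c) = r"
    "\<And>w. w \<in> L \<Longrightarrow> w \<noteq> u \<Longrightarrow> w \<noteq> u + v \<Longrightarrow> r < N (w - c)"
proof -
  obtain x where x: "N x = N (x - v)" "\<And>w. w \<in> L - {0, v} \<Longrightarrow> N (x - v) < N (x - w)"
    using v by (auto simp: voronoi_relevant_def)
  show ?thesis
  proof (rule that[of "u + x" "N x"])
    show "N (u - (u + x)) = N x" by (simp add: is_norm_minus[OF N])
    show "N (u + v - (u + x)) = N x" using x(1) by (simp add: is_norm_commute[OF N, of v])
    fix w assume "w \<in> L" "w \<noteq> u" "w \<noteq> u + v"
    then have "w - u \<in> L - {0, v}" using lattice_diff u by auto
    then have "N (x - v) < N (x - (w - u))" by (rule x)
    also have "N (x - (w - u)) = N (w - (u + x))"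
      using is_norm_commute[OF N, of "x - (w - u)" 0] by (simp add: algebra_simps)
    finally show "N x < N (w - (u + x))" using x(1) by simp
  qed
qed

end

section \<open>Noncrossing of Delaunay edges\<close>

text \<open>Each edge has an empty ball with its ends on the boundary. Since the edges share no
  endpoint, the ends of each lie strictly outside the ball of the other.\<close>

lemma voronoi_relevant_noncrossing:
  fixes L :: "(real ^ 2) set"
  assumes L: "full_rank_lattice L" and N: "is_norm N"
    and v: "voronoi_relevant N L v" and w: "voronoi_relevant N L w"
    and u: "u \<in> L" and t: "t \<in> L"
    and disj: "{u, u + v} \<inter> {t, t + w} = {}" and indep: "cross2 v w \<noteq> 0"
  shows "closed_segment u (u + v) \<inter> closed_segment t (t + w) = {}"
proof (rule ccontr)
  assume "\<not> ?thesis"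
  then obtain z where z: "z \<in> closed_segment u (u + v)" "z \<in> closed_segment t (t + w)" by blast
  have vw: "u + v \<in> L" "t + w \<in> L"
    using v w u t lattice_add[OF L] by (auto simp: voronoi_relevant_def)
  obtain c r where c: "N (u - c) = r" "N (u + v - c) = r"
    "\<And>y. y \<in> L \<Longrightarrow> y \<noteq> u \<Longrightarrow> y \<noteq> u + v \<Longrightarrow> r < N (y - c)"
    using voronoi_relevant_empty_ball[OF L N v u] by blast
  obtain c' r' where c': "N (t - c') = r'" "N (t + w - c') = r'"
    "\<And>y. y \<in> L \<Longrightarrow> y \<noteq> t \<Longrightarrow> y \<noteq> t + w \<Longrightarrow> r' < N (y - c')"
    using voronoi_relevant_empty_ball[OF L N w t] by blast
  have "cross2 (u - (u + v)) (t - (t + w)) \<noteq> 0"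
    using indep by (simp add: cross2_def)
  then show False
    by (rule norm_balls_chords_disjoint[OF N _ _ _ _ _ _ _ _ z, rotated -1, of c r r' c'])
      (use c c' u t vw disj in auto)
qed

section \<open>Coordinates with respect to two lattice vectors\<close>

lemma cross2_zero_imp_parallel:
  assumes "cross2 a b = 0" "a \<noteq> 0"
  shows "b \<in> span {a}"
proof -
  \<comment> \<open>A quarter turn of \<open>a\<close>, so that \<open>cross2 c a\<close> is the
    squared Euclidean length of \<open>a\<close>.\<close>
  define c :: "real ^ 2" where "c = vector [a $ 2, - a $ 1]"
  have ca: "cross2 c a = a $ 1 * a $ 1 + a $ 2 * a $ 2"
    by (simp add: c_def cross2_def)
  have "a $ 1 \<noteq> 0 \<or> a $ 2 \<noteq> 0"
    using assms(2) by (auto simp: vec_eq_iff forall_2)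
  then have "cross2 c a \<noteq> 0"
    unfolding ca by (simp add: sum_squares_eq_zero_iff)
  moreover have "cross2 c a *\<^sub>R b = cross2 c b *\<^sub>R a"
    using cross2_cyclic[of a b c] assms(1) by simp
  ultimately have "b = (inverse (cross2 c a) * cross2 c b) *\<^sub>R a"
    by (metis left_inverse scaleR_one scaleR_scaleR)
  then show ?thesis by (metis span_base span_scale singletonI)
qed

lemma cross2_coordinates:
  assumes "cross2 e f \<noteq> 0"
  obtains \<alpha> \<beta> where "w = \<alpha> *\<^sub>R e + \<beta> *\<^sub>R f"
proof
  have "cross2 e f *\<^sub>R w = cross2 w f *\<^sub>R e + cross2 e w *\<^sub>R f"
    using cross2_cyclic[of e f w] cross2_swap[of w e] by (simp add: algebra_simps)
  then have "inverse (cross2 e f) *\<^sub>R (cross2 e f *\<^sub>R w)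
      = inverse (cross2 e f) *\<^sub>R (cross2 w f *\<^sub>R e + cross2 e w *\<^sub>R f)" by simp
  then show "w = (inverse (cross2 e f) * cross2 w f) *\<^sub>R e + (inverse (cross2 e f) * cross2 e w) *\<^sub>R f"
    using assms by (simp add: scaleR_add_right)
qed

lemma voronoi_relevant_coefficient:
  fixes L :: "(real ^ 2) set"
  assumes L: "full_rank_lattice L" and N: "is_norm N"
    and e: "voronoi_relevant N L e" and f: "f \<in> L" and indep: "cross2 e f \<noteq> 0"
    and v: "voronoi_relevant N L v" and veq: "v = of_int a *\<^sub>R e + of_int b *\<^sub>R f"
  shows "\<bar>b\<bar> \<le> 1"
proof (rule ccontr)
  assume "\<not> \<bar>b\<bar> \<le> 1"
  then have b: "\<bar>b\<bar> \<ge> 2" "b \<noteq> 0" by auto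
  \<comment> \<open>The segment from \<open>0\<close> to \<open>v\<close> crosses the first lattice line parallel to \<open>e\<close> within the edge
    from \<open>u\<close> to \<open>u + e\<close>; neither end of that edge is an end of the segment.\<close>
  define j where "j = \<lfloor>of_int a / \<bar>of_int b :: real\<bar>\<rfloor>"
  define \<theta> :: real where "\<theta> = of_int a / \<bar>of_int b\<bar> - of_int j"
  have \<theta>: "0 \<le> \<theta>" "\<theta> \<le> 1"
    unfolding \<theta>_def j_def by linarith+
  define u where "u = of_int j *\<^sub>R e + of_int (sgn b) *\<^sub>R f"
  have eL: "e \<in> L" using e by (simp add: voronoi_relevant_def)
  have uL: "u \<in> L"
    unfolding u_def by (intro lattice_add[OF L] lattice_scale_int[OF L] eL f)
  define z where "z = (1 / \<bar>of_int b\<bar>) *\<^sub>R v"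
  have bs: "of_int b / \<bar>of_int b :: real\<bar> = of_int (sgn b)"
    using b(2) by (cases "b > 0") auto
  have "z = (of_int a / \<bar>of_int b\<bar>) *\<^sub>R e + (of_int b / \<bar>of_int b :: real\<bar>) *\<^sub>R f"
    by (simp add: z_def veq scaleR_add_right)
  then have "z = u + \<theta> *\<^sub>R e"
    unfolding bs by (simp add: u_def \<theta>_def algebra_simps)
  then have z1: "z \<in> closed_segment u (u + e)"
    using \<theta> by (auto simp: in_segment algebra_simps intro!: exI[of _ \<theta>])
  have "1 / \<bar>of_int b :: real\<bar> \<le> 1" using b by (simp add: divide_simps)
  then have z2: "z \<in> closed_segment 0 (0 + v)"
    by (auto simp: in_segment z_def intro!: exI[of _ "1 / \<bar>of_int b\<bar>"])
  \<comment> \<open>Up to the factor \<open>cross2 e f\<close>, \<open>cross2 e\<close> reads off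
    the coefficient of \<open>f\<close>: \<open>sgn b\<close> at both ends of the edge, but 0 and
    \<open>b\<close> at the ends of the segment.\<close>
  have cu: "cross2 e u = of_int (sgn b) * cross2 e f" "cross2 e (u + e) = of_int (sgn b) * cross2 e f"
    and cv: "cross2 e v = of_int b * cross2 e f"
    by (simp_all add: u_def veq cross2_linear)
  have "sgn b \<noteq> 0" "sgn b \<noteq> b" using b by (auto simp: sgn_if)
  then have "cross2 e u \<noteq> 0" "cross2 e (u + e) \<noteq> 0" "cross2 e u \<noteq> cross2 e v"
    "cross2 e (u + e) \<noteq> cross2 e v"
    using indep unfolding cu cv by auto
  moreover have "cross2 e 0 = 0" by (simp add: cross2_def)
  ultimately have "u \<noteq> 0" "u + e \<noteq> 0" "u \<noteq> v" "u + e \<noteq> v" by metis+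
  then have "{0, 0 + v} \<inter> {u, u + e} = {}" by auto
  moreover have "cross2 v e \<noteq> 0"
    using cv b(2) indep cross2_swap[of v e] by simp
  ultimately have "closed_segment 0 (0 + v) \<inter> closed_segment u (u + e) = {}"
    by (intro voronoi_relevant_noncrossing[OF L N v e lattice_zero[OF L] uL])
  then show False using z1 z2 by blast
qed

text \<open>Rounding both coordinates of \<open>w\<close> leaves a remainder with coefficients at
  most 1/2 in absolute value. If nonzero, it is strictly shorter than \<open>f\<close>, hence a
  multiple of \<open>e\<close>, and then at most half as long as \<open>e\<close>, against
  minimality.\<close>

lemma successive_minima_generate:
  fixes L :: "(real ^ 2) set"
  assumes L: "full_rank_lattice L" and N: "strictly_convex_norm N"
    and e: "e \<in> L" "e \<noteq> 0" "\<And>w. w \<in> L \<Longrightarrow> w \<noteq> 0 \<Longrightarrow> N e \<le> N w"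
    and f: "f \<in> L" "f \<notin> span {e}" "\<And>w. w \<in> L \<Longrightarrow> w \<notin> span {e} \<Longrightarrow> N f \<le> N w"
    and w: "w \<in> L"
  obtains a b where "w = of_int a *\<^sub>R e + of_int b *\<^sub>R f"
proof -
  have n: "is_norm N" using N by (simp add: strictly_convex_norm_def)
  have ind: "cross2 e f \<noteq> 0" using cross2_zero_imp_parallel e(2) f(2) by blast
  obtain \<alpha> \<beta> where w_eq: "w = \<alpha> *\<^sub>R e + \<beta> *\<^sub>R f" using cross2_coordinates[OF ind] by blast
  define \<alpha>' \<beta>' where "\<alpha>' = \<alpha> - of_int (round \<alpha>)" and "\<beta>' = \<beta> - of_int (round \<beta>)"
  have small: "\<bar>\<alpha>'\<bar> \<le> 1 / 2" "\<bar>\<beta>'\<bar> \<le> 1 / 2"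
    using of_int_round_abs_le[of \<alpha>] of_int_round_abs_le[of \<beta>]
    by (simp_all add: \<alpha>'_def \<beta>'_def abs_minus_commute)
  define y where "y = w - (of_int (round \<alpha>) *\<^sub>R e + of_int (round \<beta>) *\<^sub>R f)"
  have yL: "y \<in> L"
    unfolding y_def by (intro lattice_diff[OF L] lattice_add[OF L] lattice_scale_int[OF L] w e f)
  have y: "y = \<alpha>' *\<^sub>R e + \<beta>' *\<^sub>R f"
    by (simp add: y_def w_eq \<alpha>'_def \<beta>'_def algebra_simps)
  have "f \<noteq> 0" using f(2) span_zero by auto
  then have ef: "N e \<le> N f" using e(3) f(1) by simp
  have le: "N (\<alpha>' *\<^sub>R e) \<le> N e / 2" "N (\<beta>' *\<^sub>R f) \<le> N f / 2"
    using mult_right_mono[OF small(1) is_norm_nonneg[OF n, of e]]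
      mult_right_mono[OF small(2) is_norm_nonneg[OF n, of f]]
    by (simp_all add: is_norm_scale[OF n])
  have "y = 0"
  proof (rule ccontr)
    assume "y \<noteq> 0"
    \<comment> \<open>Strict convexity needs distinct summands; by independence equal ones would
      both be 0.\<close>
    have ne: "\<alpha>' *\<^sub>R e \<noteq> \<beta>' *\<^sub>R f"
    proof
      assume eq: "\<alpha>' *\<^sub>R e = \<beta>' *\<^sub>R f"
      have "\<alpha>' * cross2 e f = 0" "\<beta>' * cross2 e f = 0"
        using arg_cong[OF eq, of "\<lambda>u. cross2 u f"] arg_cong[OF eq, of "cross2 e"]
        by (simp_all add: cross2_linear)
      then show False using ind y \<open>y \<noteq> 0\<close> by simp
    qed
    have "N y < 2 * (N f / 2)"
      unfolding y using le ef ne by (intro strictly_convex_norm_add_less[OF N]) auto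
    then have "y \<in> span {e}" using f(3)[OF yL] by fastforce
    then obtain k where "y = k *\<^sub>R e" by (auto simp: span_singleton)
    then have "\<beta>' * cross2 e f = 0"
      using arg_cong[OF y, of "cross2 e"] by (simp add: cross2_linear)
    then have "y = \<alpha>' *\<^sub>R e" using y ind by simp
    then have "N y \<le> N e / 2" using le by simp
    moreover have "0 < N e"
      using e(2) is_norm_eq_0[OF n, of e] is_norm_nonneg[OF n, of e] by linarith
    ultimately show False using e(3)[OF yL \<open>y \<noteq> 0\<close>] by simp
  qed
  then have "w = of_int (round \<alpha>) *\<^sub>R e + of_int (round \<beta>) *\<^sub>R f" by (simp add: y_def)
  then show ?thesis by (rule that)
qed

section \<open>Counting the relevant vectors\<close>

theorem proposition9:
  fixes L :: "(real ^ 2) set" and N :: "real ^ 2 \<Rightarrow> real"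
  assumes "full_rank_lattice L"
    and "strictly_convex_norm N"
  shows "card {v. voronoi_relevant N L v} = 4 \<or> card {v. voronoi_relevant N L v} = 6"
proof -
  note L = assms(1) and N = assms(2)
  have n: "is_norm N" using N by (simp add: strictly_convex_norm_def)
  let ?V = "voronoi_relevant N L"
  have dim: "\<not> L \<subseteq> span {x}" for x
  proof
    assume "L \<subseteq> span {x}"
    then have "span {x} = (UNIV :: (real ^ 2) set)"
      using span_minimal[of L "span {x}"] lattice_span[OF L] by auto
    then have "dim (UNIV :: (real ^ 2) set) \<le> card {x}"
      using dim_le_card[of UNIV "{x}"] by simp
    then show False by (simp add: dim_UNIV)
  qed
  have "\<not> L \<subseteq> {0}" using dim[of 0] by auto
  then obtain e where e: "e \<in> L" "e \<notin> {0}" "\<And>w. w \<in> L \<Longrightarrow> w \<notin> {0} \<Longrightarrow> N e \<le> N w"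
    using lattice_minimal_outside[OF L n, of "{0}"] by blast
  obtain f where f: "f \<in> L" "f \<notin> span {e}" "\<And>w. w \<in> L \<Longrightarrow> w \<notin> span {e} \<Longrightarrow> N f \<le> N w"
    using lattice_minimal_outside[OF L n dim[of e]] by blast
  have Ve: "?V e"
    using e by (intro voronoi_relevant_minimal[OF L N, of "{0}"]) auto
  have Vf: "?V f"
    using f by (intro voronoi_relevant_minimal[OF L N, of "span {e}"]) auto
  have ind: "cross2 e f \<noteq> 0"
    using cross2_zero_imp_parallel[of e f] e(2) f(2) by auto
  \<comment> \<open>Counting is transferred to the integer coordinate pairs in
    \<open>I\<close>.\<close>
  define \<phi> where "\<phi> = (\<lambda>(i, j). of_int i *\<^sub>R e + of_int j *\<^sub>R f)"
  have inj: "inj \<phi>"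
  proof (rule injI)
    fix s t assume eq: "\<phi> s = \<phi> t"
    have "cross2 e (\<phi> x) = of_int (snd x) * cross2 e f"
      "cross2 (\<phi> x) f = of_int (fst x) * cross2 e f" for x
      by (auto simp: \<phi>_def cross2_linear split: prod.split)
    with eq ind show "s = t"
      by (metis mult_right_cancel of_int_eq_iff prod_eqI)
  qed
  have sym: "?V (- v) \<longleftrightarrow> ?V v" for v
    using voronoi_relevant_minus[OF L n, of v] voronoi_relevant_minus[OF L n, of "- v"] by auto
  define I where "I = {s. ?V (\<phi> s)}"
  have \<phi>_minus: "\<phi> (- i, - j) = - \<phi> (i, j)" for i j
    by (simp add: \<phi>_def)
  have I_sym: "(- i, - j) \<in> I \<longleftrightarrow> (i, j) \<in> I" for i j
    by (simp add: I_def \<phi>_minus sym)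
  have "{v. ?V v} = \<phi> ` I"
  proof -
    have "\<exists>s. v = \<phi> s" if "?V v" for v
    proof -
      have "v \<in> L" using that by (simp add: voronoi_relevant_def)
      then obtain a b where "v = of_int a *\<^sub>R e + of_int b *\<^sub>R f"
        using successive_minima_generate[OF L N _ _ _ f, of v] e by auto
      then show ?thesis by (intro exI[of _ "(a, b)"]) (simp add: \<phi>_def)
    qed
    then show ?thesis by (auto simp: I_def)
  qed
  then have card: "card {v. ?V v} = card I"
    using card_image[OF inj_on_subset[OF inj subset_UNIV]] by simp
  have axes: "(1, 0) \<in> I" "(0, 1) \<in> I" "(- 1, 0) \<in> I" "(0, - 1) \<in> I"
    using Ve Vf sym by (auto simp: I_def \<phi>_def)
  have "(0, 0) \<notin> I" by (simp add: I_def \<phi>_def voronoi_relevant_def)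
  have range: "i \<in> {-1, 0, 1} \<and> j \<in> {-1, 0, 1}" if "(i, j) \<in> I" for i j
  proof -
    have V: "?V (\<phi> (i, j))" using that by (simp add: I_def)
    have "\<bar>j\<bar> \<le> 1"
      by (rule voronoi_relevant_coefficient[OF L n Ve f(1) ind V, where a = i]) (simp add: \<phi>_def)
    moreover have "\<bar>i\<bar> \<le> 1"
      by (rule voronoi_relevant_coefficient[OF L n Vf e(1) _ V, where a = j])
        (use ind in \<open>auto simp: \<phi>_def cross2_swap[of f e]\<close>)
    ultimately show ?thesis by auto
  qed
  \<comment> \<open>The diagonals from 0 to \<open>e + f\<close> and from \<open>f\<close> to
    \<open>e\<close> share their midpoint but no endpoint.\<close>
  have diag: "\<not> ((1, 1) \<in> I \<and> (1, -1) \<in> I)"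
  proof
    assume "(1, 1) \<in> I \<and> (1, -1) \<in> I"
    then have V: "?V (e + f)" "?V (e - f)" by (auto simp: I_def \<phi>_def)
    have "e \<noteq> 0" "f \<noteq> 0" using ind by (auto simp: cross2_def)
    then have "{0, 0 + (e + f)} \<inter> {f, f + (e - f)} = {}" by auto
    moreover have "cross2 (e + f) (e - f) \<noteq> 0"
      using ind by (simp add: cross2_linear cross2_swap[of f e])
    ultimately have "closed_segment 0 (0 + (e + f)) \<inter> closed_segment f (f + (e - f)) = {}"
      by (intro voronoi_relevant_noncrossing[OF L n V lattice_zero[OF L] f(1)])
    moreover have "midpoint 0 (0 + (e + f)) = midpoint f (f + (e - f))"
      by (simp add: midpoint_def algebra_simps)
    ultimately show False
      using midpoint_in_closed_segment by (metis disjoint_iff)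
  qed
  let ?A = "{(1, 0), (0, 1), (-1, 0), (0, -1)} :: (int \<times> int) set"
  \<comment> \<open>As \<open>I\<close> lies in a grid of nine points, equality with
    \<open>J\<close> only needs checking there.\<close>
  have eqI: "I = J" if "J \<subseteq> I" "\<And>i j. i \<in> {-1, 0, 1} \<Longrightarrow> j \<in> {-1, 0, 1} \<Longrightarrow> (i, j) \<notin> J \<Longrightarrow> (i, j) \<notin> I" for J
    using that range by (intro equalityI subrelI) blast+
  have opp: "(-1, -1) \<in> I \<longleftrightarrow> (1, 1) \<in> I" "(-1, 1) \<in> I \<longleftrightarrow> (1, -1) \<in> I"
    using I_sym[of 1 1] I_sym[of 1 "- 1"] by simp_all
  \<comment> \<open>The four axis points always belong to \<open>I\<close>; at most one of the two
    antipodal pairs of diagonal points joins them.\<close>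
  show ?thesis
  proof (cases "(1, 1) \<in> I")
    case True
    then have "(1, -1) \<notin> I" using diag by simp
    then have "I = ?A \<union> {(1, 1), (-1, -1)}"
      using True axes opp \<open>(0, 0) \<notin> I\<close> by (intro eqI) auto
    then show ?thesis unfolding card by simp
  next
    case no_sum: False
    show ?thesis
    proof (cases "(1, -1) \<in> I")
      case True
      then have "I = ?A \<union> {(1, -1), (-1, 1)}"
        using no_sum axes opp \<open>(0, 0) \<notin> I\<close> by (intro eqI) auto
      then show ?thesis unfolding card by simp
    next
      case False
      then have "I = ?A"
        using no_sum axes opp \<open>(0, 0) \<notin> I\<close> by (intro eqI) auto
      then show ?thesis unfolding card by simp
    qed
  qed
qed

end
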